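(* Let $d \in \mathbb{N}$, $d\ge 1$, and let $K \subset \mathbb{R}^d$ be a compact set. The family of two-layer AdderNets with ReLU activation universally approximates every $f \in L^1(K)$. That is, for every $f \in L^1(K)$ and every $\epsilon > 0$ there is a two-layer AdderNet $A:\mathbb{R}^d\to\mathbb{R}$ with ReLU activation such that $$\int_K |f(\mathbf{X}) - A(\mathbf{X})| \, d\mathbf{X} \leq \epsilon .$$
   Context: $\|\cdot\|_1$ denotes the $\ell_1$-norm on $\mathbb{R}^k$, i.e. $\|\mathbf{x}\|_1=\sum_j |x_j|$. $L^1(K)$ is the space of real-valued Lebesgue integrable functions on $K$; integrals are with respect to Lebesgue measure. An adder layer is a map $L:\mathbb{R}^{d_{in}}\to\mathbb{R}^{d_{out}}$ of the form $L(\mathbf{X})_i = a_i\|\mathbf{W}_i-\mathbf{X}\|_1 + b_i$ for $i=1,\dots,d_{out}$, where $\mathbf{W}_i\in\mathbb{R}^{d_{in}}$ and $a_i,b_i\in\mathbb{R}$ are arbitrary parameters. $\mathrm{ReLU}(x)=\max(x,0)$, applied coordinatewise to vectors. A two-layer AdderNet with ReLU activation on $\mathbb{R}^d$ is a function $A:\mathbb{R}^d\to\mathbb{R}$ of the form $A(\mathbf{X})=L_2(\mathrm{ReLU}(L_1(\mathbf{X})))$, where $L_1:\mathbb{R}^d\to\mathbb{R}^t$ and $L_2:\mathbb{R}^t\to\mathbb{R}$ are adder layers and the number $t\in\mathbb{N}$ of hidden units is arbitrary. *)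

theory Defs
  imports "HOL-Analysis.Analysis"
begin

text \<open>
  The number of hidden units of a network is existentially quantified, so it cannot be a type.
  A vector of \<open>\<real>\<^sup>k\<close> is therefore a real-valued function on an index set of cardinality \<open>k\<close>;
  values outside the index set are ignored.
\<close>

definition l1_norm :: "'j set \<Rightarrow> ('j \<Rightarrow> real) \<Rightarrow> real" where
  "l1_norm J x = (\<Sum>j\<in>J. \<bar>x j\<bar>)"

text \<open>
  The argument \<open>J\<close> indexes the input coordinates; \<open>W i\<close>, \<open>a i\<close>, \<open>b i\<close> are the parameters of the
  output coordinate \<open>i\<close>.
\<close>

definition adder_layer ::
  "'j set \<Rightarrow> ('i \<Rightarrow> 'j \<Rightarrow> real) \<Rightarrow> ('i \<Rightarrow> real) \<Rightarrow> ('i \<Rightarrow> real) \<Rightarrow> ('j \<Rightarrow> real) \<Rightarrow> ('i \<Rightarrow> real)" where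
  "adder_layer J W a b X = (\<lambda>i. a i * l1_norm J (\<lambda>j. W i j - X j) + b i)"

definition relu :: "real \<Rightarrow> real" where
  "relu x = max x 0"

text \<open>
  The input coordinates are indexed by \<open>'d\<close>, the hidden units by \<open>{..<t}\<close>, and the single
  output coordinate by \<open>unit\<close>.
\<close>

definition two_layer_relu_addernet :: "(real ^ 'd \<Rightarrow> real) \<Rightarrow> bool" where
  "two_layer_relu_addernet A \<longleftrightarrow>
    (\<exists>(t::nat) (W1 :: nat \<Rightarrow> 'd \<Rightarrow> real) a1 b1 (W2 :: unit \<Rightarrow> nat \<Rightarrow> real) a2 b2.
      \<forall>X. A X = adder_layer {..<t} W2 a2 b2 (relu \<circ> adder_layer UNIV W1 a1 b1 (($) X)) ())"

end

theory Submission
  imports Defs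
begin

text \<open>
  Every linear combination of translates of the bump \<open>X \<mapsto> max (r - \<parallel>X\<parallel>\<^sub>1) 0\<close> is a network: the moduli of
  the coefficients go into the first layer, and \<open>\<bar>w - h\<bar>\<close> equals \<open>h\<close> for \<open>w = 0\<close> and \<open>w - h\<close> for \<open>w\<close> an
  upper bound of the hidden unit \<open>h\<close>, so the signs come from the second layer. A continuous function
  is uniformly approximated on compact sets by its convolution with a normalized narrow bump, and
  this convolution by Riemann sums, which are such linear combinations. Continuous functions are
  dense in \<open>L\<^sup>1\<close>.
\<close>

section \<open>Bumps\<close>

text \<open>A single hidden unit with a = -1 and b = r: a tent of height \<open>r\<close> (for r >
  0) over the l1-ball of radius \<open>r\<close> around \<open>w\<close>.\<close>

definition bump :: "real \<Rightarrow> real ^ 'd \<Rightarrow> real ^ 'd \<Rightarrow> real" where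
  "bump r w X = relu (r - l1_norm UNIV (\<lambda>j. w $ j - X $ j))"

lemma l1_norm_eq: "l1_norm UNIV (\<lambda>j. w $ j - X $ j) = (\<Sum>j\<in>UNIV. \<bar>(w - X) $ j\<bar>)"
  by (simp add: l1_norm_def)

lemma bump_nonneg: "0 \<le> bump r w X"
  by (simp add: bump_def relu_def)

lemma bump_le:
  assumes "0 \<le> r"
  shows "bump r w X \<le> r"
  using assms by (simp add: bump_def relu_def l1_norm_def sum_nonneg)

text \<open>The Euclidean norm is at most the l1 norm, so for fixed \<open>w\<close> the support
  lies in a Euclidean ball; this lets the later estimates work with \<open>dist\<close>.\<close>

lemma bump_eq_0:
  assumes "r \<le> dist w X"
  shows "bump r w X = 0"
  using assms norm_le_l1_cart[of "w - X"]
  by (simp add: bump_def relu_def l1_norm_eq dist_norm)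

lemma bump_shift: "bump r w X = bump r (w - X) 0"
  by (simp add: bump_def)

lemma l1_norm_le_dist:
  fixes w X :: "real ^ 'd"
  shows "l1_norm UNIV (\<lambda>j. w $ j - X $ j) \<le> CARD('d) * dist w X"
proof -
  have "(\<Sum>j\<in>UNIV. \<bar>(w - X) $ j\<bar>) \<le> (\<Sum>j\<in>(UNIV::'d set). norm (w - X))"
    by (intro sum_mono component_le_norm_cart)
  then show ?thesis by (simp add: l1_norm_eq dist_norm)
qed

lemma bump_ge:
  fixes w X :: "real ^ 'd"
  shows "r - CARD('d) * dist w X \<le> bump r w X"
  using l1_norm_le_dist[of w X] by (simp add: bump_def relu_def)

text \<open>Reverse triangle inequality in each coordinate, then \<open>relu\<close> is 1-Lipschitz.
  This controls the Riemann sum error when a centre \<open>y\<close> is replaced by a sample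
  point.\<close>

lemma bump_lipschitz:
  fixes w w' X :: "real ^ 'd"
  shows "\<bar>bump r w X - bump r w' X\<bar> \<le> CARD('d) * dist w w'"
proof -
  have "\<bar>l1_norm UNIV (\<lambda>j. w $ j - X $ j) - l1_norm UNIV (\<lambda>j. w' $ j - X $ j)\<bar>
      = \<bar>\<Sum>j\<in>UNIV. \<bar>w $ j - X $ j\<bar> - \<bar>w' $ j - X $ j\<bar>\<bar>"
    by (simp add: l1_norm_def sum_subtractf)
  also have "\<dots> \<le> (\<Sum>j\<in>UNIV. \<bar>\<bar>w $ j - X $ j\<bar> - \<bar>w' $ j - X $ j\<bar>\<bar>)"
    by (rule sum_abs)
  also have "\<dots> \<le> l1_norm UNIV (\<lambda>j. w $ j - w' $ j)"
    unfolding l1_norm_def by (intro sum_mono) linarith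
  also have "\<dots> \<le> CARD('d) * dist w w'"
    by (rule l1_norm_le_dist)
  finally show ?thesis by (simp add: bump_def relu_def)
qed

lemma continuous_on_bump: "continuous_on S (bump r w)"
  unfolding bump_def relu_def l1_norm_def by (intro continuous_intros)

lemma continuous_on_bump_center: "continuous_on S (\<lambda>w. bump r w X)"
  unfolding bump_def relu_def l1_norm_def by (intro continuous_intros)

text \<open>The centre is the integration variable, since the convolution integrates over centres
  with \<open>X\<close> fixed.\<close>

lemma integrable_bump: "integrable lborel (\<lambda>w. bump r w X)"
proof -
  have "integrable lborel (\<lambda>w. indicator (cball X r) w *\<^sub>R bump r w X)"
    by (intro borel_integrable_compact continuous_on_bump_center compact_cball)
  moreover have "(\<lambda>w. indicator (cball X r) w *\<^sub>R bump r w X) = (\<lambda>w. bump r w X)"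
    by (auto simp: indicator_def fun_eq_iff dist_commute bump_eq_0)
  ultimately show ?thesis by (simp only:)
qed

text \<open>Translation invariance of \<open>lborel\<close>; it makes one normalizing constant serve
  for all \<open>X\<close>.\<close>

lemma integral_bump_center:
  fixes X :: "real ^ 'd"
  shows "(LINT w|lborel. bump r w X) = (LINT w|lborel. bump r w (0 :: real ^ 'd))"
proof -
  have "(LINT w|lborel. bump r w (0 :: real ^ 'd)) = (LINT w|distr lborel borel ((+) (-X)). bump r w 0)"
    by (simp add: lborel_distr_plus)
  also have "\<dots> = (LINT w|lborel. bump r (- X + w) 0)"
    by (intro integral_distr borel_measurable_continuous_onI continuous_on_bump_center) simp
  also have "\<dots> = (LINT w|lborel. bump r w X)"
    by (subst (2) bump_shift) simp
  finally show ?thesis by simp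
qed

lemma integral_bump_pos:
  assumes "r > 0"
  shows "0 < (LINT w|lborel. bump r w (X :: real ^ 'd))"
proof -
  \<comment> \<open>Chosen so that CARD('d) * s = r / 2; then \<open>bump_ge\<close> keeps the bump
    at least r / 2 on the ball of radius \<open>s\<close>.\<close>
  define s where "s = r / (2 * CARD('d))"
  have s: "s > 0" using assms by (simp add: s_def)
  have "0 < r / 2 * measure lborel (ball X s)"
    using assms content_ball_pos[OF s, of X] by simp
  also have "\<dots> = (LINT w|lborel. r / 2 * indicator (ball X s) w)"
    by simp
  also have "\<dots> \<le> (LINT w|lborel. bump r w X)"
  proof (rule integral_mono)
    show "integrable lborel (\<lambda>w. r / 2 * indicator (ball X s) w)"
      using emeasure_lborel_ball_finite[of X s] by (auto intro!: integrable_real_indicator)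
    fix w
    show "r / 2 * indicator (ball X s) w \<le> bump r w X"
    proof (cases "w \<in> ball X s")
      case True
      then have "CARD('d) * dist w X \<le> CARD('d) * s"
        by (simp add: dist_commute)
      also have "\<dots> = r / 2" by (simp add: s_def)
      finally show ?thesis using bump_ge[of r w X] True by simp
    qed (simp add: bump_nonneg)
  qed (rule integrable_bump)
  finally show ?thesis .
qed

section \<open>Networks\<close>

lemma two_layer_relu_addernet_bump_sum:
  fixes w :: "nat \<Rightarrow> real ^ 'd"
  assumes "0 \<le> r"
  shows "two_layer_relu_addernet (\<lambda>X. \<Sum>i<N. c i * bump r (w i) X)"
  unfolding two_layer_relu_addernet_def
proof (intro exI allI)
  fix X :: "real ^ 'd"
  let ?v = "\<lambda>i. if c i \<ge> 0 then 0 else \<bar>c i\<bar> * r"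
  \<comment> \<open>\<open>relu\<close> is positively homogeneous, so the factor \<bar>c i\<bar> can
    be absorbed into the parameters of the hidden unit.\<close>
  have hidden: "(relu \<circ> adder_layer UNIV (\<lambda>i j. w i $ j) (\<lambda>i. - \<bar>c i\<bar>) (\<lambda>i. \<bar>c i\<bar> * r) (($) X)) i
      = \<bar>c i\<bar> * bump r (w i) X" for i
    using max_mult_distrib_left[of "\<bar>c i\<bar>" "r - l1_norm UNIV (\<lambda>j. w i $ j - X $ j)" 0]
    by (simp add: adder_layer_def bump_def relu_def algebra_simps)
  have "\<bar>?v i - \<bar>c i\<bar> * bump r (w i) X\<bar> = c i * bump r (w i) X + ?v i" for i
  proof -
    have "\<bar>c i\<bar> * bump r (w i) X \<le> \<bar>c i\<bar> * r"
      by (intro mult_left_mono bump_le assms) simp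
    then show ?thesis
      by (auto simp: bump_nonneg abs_mult)
  qed
  \<comment> \<open>The bias of the output layer cancels the constants \<open>?v i\<close> left over
    from the negative coefficients.\<close>
  then show "(\<Sum>i<N. c i * bump r (w i) X) =
      adder_layer {..<N} (\<lambda>_. ?v) (\<lambda>_. 1) (\<lambda>_. - (\<Sum>i<N. ?v i))
        (relu \<circ> adder_layer UNIV (\<lambda>i j. w i $ j) (\<lambda>i. - \<bar>c i\<bar>) (\<lambda>i. \<bar>c i\<bar> * r) (($) X)) ()"
    unfolding adder_layer_def[of "{..<N}"] l1_norm_def hidden
    by (simp add: sum.distrib)
qed

section \<open>Uniform approximation of continuous functions\<close>

text \<open>Total boundedness gives a finite cover by \<delta>-balls, and \<open>disjointed\<close>
  makes it disjoint without enlarging any piece. The \<open>w i\<close> are the sample points of a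
  Riemann sum.\<close>

lemma compact_small_partition:
  fixes S :: "'a::euclidean_space set"
  assumes "compact S" and "\<delta> > 0"
  obtains N :: nat and P w where "\<And>i. P i \<in> sets borel" "disjoint_family P" "(\<Union>i<N. P i) = S"
    "\<And>i. i < N \<Longrightarrow> w i \<in> S" "\<And>i x. x \<in> P i \<Longrightarrow> dist x (w i) < \<delta>"
proof -
  obtain T where T: "finite T" "T \<subseteq> S" "S \<subseteq> (\<Union>x\<in>T. ball x \<delta>)"
    using seq_compact_imp_totally_bounded[of S] assms compact_imp_seq_compact by metis
  obtain w :: "nat \<Rightarrow> 'a" and N where w: "T = w ` {i. i < N}"
    using finite_imp_nat_seg_image_inj_on[OF T(1)] by blast
  \<comment> \<open>The empty default from \<open>N\<close> on makes the distance bound hold for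
    every index.\<close>
  define B where "B i = (if i < N then S \<inter> ball (w i) \<delta> else {})" for i
  have B: "B i \<in> sets borel" for i
    using compact_imp_closed[OF assms(1)] by (simp add: B_def borel_closed borel_open sets.Int)
  show thesis
  proof
    show "disjointed B i \<in> sets borel" for i
      using sets.range_disjointed_sets[of B borel] B by blast
    show "disjoint_family (disjointed B)"
      by (rule disjoint_family_disjointed)
    have "(\<Union>i<N. disjointed B i) = (\<Union>i<N. B i)"
      using finite_UN_disjointed_eq[of B N] by (simp add: atLeast0LessThan)
    also have "\<dots> = S"
      using T(3) by (auto simp: B_def w)
    finally show "(\<Union>i<N. disjointed B i) = S" .
    show "w i \<in> S" if "i < N" for i
      using that T(2) w by auto
    show "dist x (w i) < \<delta>" if "x \<in> disjointed B i" for i x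
      using that disjointed_subset[of B i] by (auto simp: B_def dist_commute split: if_splits)
  qed
qed

text \<open>The convolution is compared with its Riemann sum under the integral sign: for fixed
  \<open>X\<close>, g X * bump r y X is close, pointwise in \<open>y\<close>, to a step function
  whose integral is \<open>C\<close> times the sum. Integrating over \<open>y\<close> and dividing
  by \<open>C\<close> leaves e / 2 from the oscillation of \<open>g\<close> and e / 2 from the
  Lipschitz bound of the bump.\<close>

lemma uniform_approx_bump_sum:
  fixes g :: "real ^ 'd \<Rightarrow> real"
  assumes g: "continuous_on UNIV g" and K: "compact K" and e: "e > 0"
  obtains N :: nat and c w r where "0 \<le> r" "\<And>X. X \<in> K \<Longrightarrow> \<bar>g X - (\<Sum>i<N. c i * bump r (w i) X)\<bar> \<le> e"
proof -
  obtain R where R: "\<And>x. x \<in> K \<Longrightarrow> norm x \<le> R"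
    using compact_imp_bounded[OF K] by (auto simp: bounded_iff)
  \<comment> \<open>The margin 1 is at least \<open>r\<close>, so bumps centred outside
    \<open>S\<close> vanish on \<open>K\<close>.\<close>
  define S where "S = cball (0 :: real ^ 'd) (R + 1)"
  have S: "compact S" by (simp add: S_def)
  have gS: "continuous_on S g" using g continuous_on_subset by blast
  obtain M where M: "M > 0" "\<And>x. x \<in> S \<Longrightarrow> \<bar>g x\<bar> \<le> M"
    using compact_imp_bounded[OF compact_continuous_image[OF gS S]]
    by (auto simp: bounded_pos)
  obtain \<eta> where \<eta>: "\<eta> > 0" "\<And>x y. x \<in> S \<Longrightarrow> y \<in> S \<Longrightarrow> dist y x < \<eta> \<Longrightarrow> \<bar>g y - g x\<bar> < e / 2"
    using compact_uniformly_continuous[OF gS S] e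
    unfolding uniformly_continuous_on_def dist_real_def by (metis half_gt_zero)
  \<comment> \<open>Both \<open>r\<close> and \<delta> are at most \<eta> / 2: if the bump at
    \<open>y\<close> is nonzero at \<open>X\<close>, the sample point near \<open>y\<close> is
    within \<eta> of \<open>X\<close>.\<close>
  define r where "r = min 1 (\<eta> / 2)"
  have r: "0 < r" "r \<le> 1" "r \<le> \<eta> / 2" using \<eta> by (auto simp: r_def)
  define C where "C = (LINT w|lborel. bump r w (0 :: real ^ 'd))"
  have C: "C > 0" unfolding C_def by (rule integral_bump_pos[OF r(1)])
  define V where "V = measure lborel S"
  have V: "V \<ge> 0" by (simp add: V_def)
  \<comment> \<open>The second bound keeps the Lipschitz error, integrated over \<open>S\<close>,
    below e / 2 * C. The summand 1 prevents division by zero when \<open>V\<close> is 0.\<close>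
  define \<delta> where "\<delta> = min (\<eta> / 2) (e * C / (2 * (CARD('d) * M * (V + 1))))"
  have \<delta>: "\<delta> > 0"
    using \<eta>(1) e C M(1) V by (simp add: \<delta>_def)
  have \<delta>_le_\<eta>: "\<delta> \<le> \<eta> / 2"
    unfolding \<delta>_def by (rule min.cobounded1)
  have \<delta>_le: "\<delta> \<le> e * C / (2 * (CARD('d) * M * (V + 1)))"
    unfolding \<delta>_def by (rule min.cobounded2)
  have \<delta>V: "M * (CARD('d) * \<delta>) * V \<le> e / 2 * C"
  proof -
    have "M * (CARD('d) * \<delta>) * V \<le> M * (CARD('d) * \<delta>) * (V + 1)"
      using M \<delta> by (intro mult_left_mono) auto
    also have "\<dots> = \<delta> * (CARD('d) * M * (V + 1))" by simp
    also have "\<dots> \<le> e / 2 * C"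
      using \<delta>_le M V by (simp add: pos_le_divide_eq mult_ac)
    finally show ?thesis .
  qed
  obtain N :: nat and P w where P: "\<And>i. P i \<in> sets borel" "disjoint_family P" "(\<Union>i<N. P i) = S"
    "\<And>i. i < N \<Longrightarrow> w i \<in> S" "\<And>i x. x \<in> P i \<Longrightarrow> dist x (w i) < \<delta>"
    using compact_small_partition[OF S \<delta>] by metis
  have finP: "emeasure lborel (P i) < \<infinity>" if "i < N" for i
  proof -
    have "emeasure lborel (P i) \<le> emeasure lborel S"
      using that P(3) by (intro emeasure_mono) (auto simp: S_def)
    also have "\<dots> < \<infinity>" using emeasure_compact_finite[OF S] by simp
    finally show ?thesis .
  qed
  \<comment> \<open>Riemann sum weights of the convolution of \<open>g\<close> with the bump
    normalized by \<open>C\<close>.\<close>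
  define c where "c i = measure lborel (P i) * g (w i) / C" for i
  have "\<bar>g X - (\<Sum>i<N. c i * bump r (w i) X)\<bar> \<le> e" if X: "X \<in> K" for X
  proof -
    let ?G = "\<lambda>y. \<Sum>i<N. indicator (P i) y * (g (w i) * bump r (w i) X)"
    have intP: "integrable lborel (\<lambda>y. indicator (P i) y * (g (w i) * bump r (w i) X))" if "i < N" for i
      using P(1) finP[OF that] by (intro integrable_mult_left integrable_real_indicator) auto
    then have intG: "integrable lborel ?G"
      by (intro Bochner_Integration.integrable_sum) auto
    have "(LINT y|lborel. ?G y) = (\<Sum>i<N. measure lborel (P i) * (g (w i) * bump r (w i) X))"
      using intP by (subst Bochner_Integration.integral_sum) auto
    also have "\<dots> = C * (\<Sum>i<N. c i * bump r (w i) X)"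
      using C by (simp add: c_def sum_distrib_left mult_ac)
    finally have G: "(LINT y|lborel. ?G y) = C * (\<Sum>i<N. c i * bump r (w i) X)" .
    have B: "(LINT y|lborel. bump r y X) = C"
      unfolding C_def by (rule integral_bump_center)
    have XS: "X \<in> S" using R[OF X] by (simp add: S_def)
    \<comment> \<open>On \<open>S\<close> the first term bounds the change of \<open>g\<close> from
      \<open>X\<close> to the sample point, the second the change of the bump from \<open>y\<close>
      to that point. Off \<open>S\<close> both the bump and the step function vanish.\<close>
    have bnd: "\<bar>g X * bump r y X - ?G y\<bar> \<le> e / 2 * bump r y X + M * (CARD('d) * \<delta>) * indicator S y" for y
    proof (cases "y \<in> S")
      case True
      then obtain i where i: "i < N" "y \<in> P i" using P(3) by auto
      have "indicator (P j) y = (if j = i then 1 else 0 :: real)" for j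
        using P(2) i by (auto simp: disjoint_family_on_def indicator_def)
      then have "?G y = (\<Sum>j<N. if j = i then g (w i) * bump r (w i) X else 0)"
        by (intro sum.cong) auto
      then have Gy: "?G y = g (w i) * bump r (w i) X"
        using i by simp
      have yw: "dist y (w i) < \<delta>" using P(5) i by blast
      have "\<bar>g X - g (w i)\<bar> * bump r y X \<le> e / 2 * bump r y X"
      proof (cases "r \<le> dist y X")
        case False
        then have "dist X (w i) < \<eta>"
          using yw r \<delta>_le_\<eta> dist_triangle[of X "w i" y] by (simp add: dist_commute)
        then show ?thesis
          using \<eta>(2)[of "w i" X] P(4) i XS by (intro mult_right_mono bump_nonneg) (simp add: less_imp_le)
      qed (simp add: bump_eq_0)
      moreover have "\<bar>g (w i)\<bar> * \<bar>bump r y X - bump r (w i) X\<bar> \<le> M * (CARD('d) * \<delta>)"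
      proof (intro mult_mono)
        have "CARD('d) * dist y (w i) \<le> CARD('d) * \<delta>"
          using yw by (intro mult_left_mono) auto
        then show "\<bar>bump r y X - bump r (w i) X\<bar> \<le> CARD('d) * \<delta>"
          using bump_lipschitz[of r y X "w i"] by linarith
      qed (use M P(4) i in auto)
      moreover have "g X * bump r y X - g (w i) * bump r (w i) X =
          (g X - g (w i)) * bump r y X + g (w i) * (bump r y X - bump r (w i) X)"
        by (simp add: algebra_simps)
      then have "\<bar>g X * bump r y X - g (w i) * bump r (w i) X\<bar> \<le>
          \<bar>g X - g (w i)\<bar> * bump r y X + \<bar>g (w i)\<bar> * \<bar>bump r y X - bump r (w i) X\<bar>"
        using abs_triangle_ineq[of "(g X - g (w i)) * bump r y X" "g (w i) * (bump r y X - bump r (w i) X)"]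
        by (simp add: abs_mult bump_nonneg)
      ultimately show ?thesis using True Gy by simp
    next
      case False
      have "r \<le> dist y X"
        using False R[OF X] r norm_triangle_ineq2[of y X] by (simp add: S_def dist_norm)
      moreover have "?G y = 0" using False P(3) by (intro sum.neutral) (auto simp: indicator_def)
      ultimately show ?thesis using False by (simp add: bump_eq_0)
    qed
    have "C * \<bar>g X - (\<Sum>i<N. c i * bump r (w i) X)\<bar> = \<bar>g X * C - C * (\<Sum>i<N. c i * bump r (w i) X)\<bar>"
      using C by (simp add: abs_mult_pos' algebra_simps)
    also have "\<dots> = \<bar>LINT y|lborel. g X * bump r y X - ?G y\<bar>"
      by (subst Bochner_Integration.integral_diff[OF integrable_mult_right[OF integrable_bump] intG])
        (simp only: G B integral_mult_right_zero)
    also have "\<dots> \<le> (LINT y|lborel. \<bar>g X * bump r y X - ?G y\<bar>)"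
      by (rule integral_abs_bound)
    also have "\<dots> \<le> (LINT y|lborel. e / 2 * bump r y X + M * (CARD('d) * \<delta>) * indicator S y)"
      using emeasure_compact_finite[OF S]
      by (intro integral_mono bnd integrable_abs Bochner_Integration.integrable_diff Bochner_Integration.integrable_add
            integrable_mult_right integrable_bump intG integrable_real_indicator) (auto simp: S_def)
    also have "\<dots> = e / 2 * C + M * (CARD('d) * \<delta>) * V"
      using emeasure_compact_finite[OF S] integrable_bump[of r X]
      by (subst Bochner_Integration.integral_add)
        (auto simp: B V_def S_def intro!: integrable_mult_right integrable_real_indicator)
    also have "\<dots> \<le> C * e" using \<delta>V by (simp add: field_simps)
    finally show ?thesis using C by simp
  qed
  then show thesis using that r(1) less_imp_le by blast
qed

section \<open>Density of continuous functions in \<open>L\<^sup>1\<close>\<close>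

text \<open>Induction over integrable functions: indicators of sets of finite measure by regularity
  and Urysohn, then sums, then dominated limits. Integrability of \<open>g\<close> is carried along
  so that the error integrals can be added and compared.\<close>

lemma integrable_lebesgue_approx_continuous:
  fixes f :: "'a::euclidean_space \<Rightarrow> real"
  assumes "integrable lebesgue f" and "e > 0"
  shows "\<exists>g. continuous_on UNIV g \<and> integrable lebesgue g \<and> (LINT x|lebesgue. \<bar>f x - g x\<bar>) < e"
  using assms
proof (induction arbitrary: e rule: integrable_induct)
  case (base A c)
  \<comment> \<open>Makes \<bar>c\<bar> * (2 * \<mu>) strictly less than \<open>e\<close>, also for
    c = 0.\<close>
  define \<mu> where "\<mu> = e / (2 * (\<bar>c\<bar> + 1))"
  have \<mu>: "\<mu> > 0" using base by (simp add: \<mu>_def add_nonneg_pos)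
  obtain T where T: "open T" "A \<subseteq> T" "T - A \<in> lmeasurable" "emeasure lebesgue (T - A) < ennreal \<mu>"
    using sets_lebesgue_outer_open[OF base(1) \<mu>] by blast
  obtain C where C: "closed C" "C \<subseteq> A" "A - C \<in> lmeasurable" "emeasure lebesgue (A - C) < ennreal \<mu>"
    using sets_lebesgue_inner_closed[OF base(1) \<mu>] by blast
  obtain h :: "'a \<Rightarrow> real" where h: "continuous_on UNIV h" "\<And>x. h x \<in> closed_segment 0 1"
      "\<And>x. x \<in> - T \<Longrightarrow> h x = 0" "\<And>x. x \<in> C \<Longrightarrow> h x = 1"
    by (rule Urysohn[of "- T" C 0 1]) (use T C in auto)
  have h01: "0 \<le> h x" "h x \<le> 1" for x using h(2)[of x] by (auto simp: closed_segment_eq_real_ivl)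
  have A: "A \<in> lmeasurable" using base by (simp add: fmeasurable_def)
  have "A \<union> (T - A) \<in> lmeasurable" using A T by (intro fmeasurable.Un)
  then have TL: "T \<in> lmeasurable" using T(2) by (simp add: Un_absorb1)
  have hm: "h \<in> borel_measurable lebesgue"
    using borel_measurable_continuous_onI[OF h(1)] by (simp add: measurable_completion)
  have hi: "integrable lebesgue h"
  proof (rule Bochner_Integration.integrable_bound[OF _ hm])
    show "integrable lebesgue (indicator T :: 'a \<Rightarrow> real)"
      using TL by (simp add: lmeasurable_iff_integrable)
    show "AE x in lebesgue. norm (h x) \<le> norm (indicator T x :: real)"
      using h(3) h01 by (intro AE_I2) (auto simp: indicator_def)
  qed
  \<comment> \<open>Off \<open>?D\<close> the function \<open>h\<close> agrees with the indicator of
    \<open>A\<close>: both are 1 on \<open>C\<close> and 0 outside \<open>T\<close>.\<close>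
  let ?D = "(T - A) \<union> (A - C)"
  have D: "?D \<in> lmeasurable" using T C by (intro fmeasurable.Un)
  have "measure lebesgue ?D \<le> measure lebesgue (T - A) + measure lebesgue (A - C)"
    using T C by (intro measure_Un_le) (auto simp: fmeasurable_def)
  also have "\<dots> < 2 * \<mu>"
    using T(3,4) C(3,4) \<mu> by (simp add: emeasure_eq_measure2 ennreal_less_iff)
  finally have mD: "measure lebesgue ?D < 2 * \<mu>" .
  have "(LINT x|lebesgue. \<bar>indicator A x *\<^sub>R c - c * h x\<bar>) \<le> (LINT x|lebesgue. \<bar>c\<bar> * indicator ?D x)"
  proof (rule integral_mono)
    show "integrable lebesgue (\<lambda>x. \<bar>indicator A x *\<^sub>R c - c * h x\<bar>)"
      using hi A by (auto simp: lmeasurable_iff_integrable)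
    show "integrable lebesgue (\<lambda>x. \<bar>c\<bar> * indicator ?D x)"
      using D by (simp add: lmeasurable_iff_integrable)
    show "\<bar>indicator A x *\<^sub>R c - c * h x\<bar> \<le> \<bar>c\<bar> * indicator ?D x" for x
    proof -
      have "\<bar>indicator A x - h x\<bar> \<le> indicator ?D x"
        using h01[of x] h(3,4)[of x] T(2) C(2) by (auto simp: indicator_def)
      then have "\<bar>c\<bar> * \<bar>indicator A x - h x\<bar> \<le> \<bar>c\<bar> * indicator ?D x"
        by (intro mult_left_mono) auto
      then show ?thesis
        by (simp add: abs_mult[symmetric] algebra_simps)
    qed
  qed
  also have "\<dots> = \<bar>c\<bar> * measure lebesgue ?D" using D by simp
  also have "\<dots> \<le> \<bar>c\<bar> * (2 * \<mu>)" using mD by (intro mult_left_mono) auto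
  also have "\<dots> < e" using base(3) by (simp add: \<mu>_def divide_simps)
  finally have "(LINT x|lebesgue. \<bar>indicator A x *\<^sub>R c - c * h x\<bar>) < e" .
  then show ?case
    using hi h(1) by (intro exI[of _ "\<lambda>x. c * h x"]) (auto intro!: continuous_intros)
next
  case (add f1 f2)
  obtain g1 g2 where g: "continuous_on UNIV g1" "integrable lebesgue g1" "(LINT x|lebesgue. \<bar>f1 x - g1 x\<bar>) < e / 2"
    "continuous_on UNIV g2" "integrable lebesgue g2" "(LINT x|lebesgue. \<bar>f2 x - g2 x\<bar>) < e / 2"
    using add.IH(1)[of "e / 2"] add.IH(2)[of "e / 2"] add.prems half_gt_zero by blast
  have "(LINT x|lebesgue. \<bar>f1 x + f2 x - (g1 x + g2 x)\<bar>)
      \<le> (LINT x|lebesgue. \<bar>f1 x - g1 x\<bar> + \<bar>f2 x - g2 x\<bar>)"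
    using add.hyps g by (intro integral_mono) auto
  also have "\<dots> < e"
    using add.hyps g by simp
  finally show ?case
    using g by (intro exI[of _ "\<lambda>x. g1 x + g2 x"]) (auto intro!: continuous_intros)
next
  case (lim f s)
  \<comment> \<open>The induction rule supplies \<bar>s i x\<bar> \<le> 2 * \<bar>f x\<bar>, so 3 *
    \<bar>f\<bar> dominates the differences.\<close>
  have "(\<lambda>i. LINT x|lebesgue. \<bar>f x - s i x\<bar>) \<longlonglongrightarrow> (LINT x|lebesgue. \<bar>f x - f x\<bar>)"
  proof (rule integral_dominated_convergence[where w = "\<lambda>x. 3 * \<bar>f x\<bar>"])
    show "AE x in lebesgue. (\<lambda>i. \<bar>f x - s i x\<bar>) \<longlonglongrightarrow> \<bar>f x - f x\<bar>"
      by (intro AE_I2 tendsto_intros lim.hyps) simp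
    show "AE x in lebesgue. norm \<bar>f x - s i x\<bar> \<le> 3 * \<bar>f x\<bar>" for i
    proof (intro AE_I2)
      fix x
      have "norm (s i x) \<le> 2 * norm (f x)"
        by (rule lim.hyps) simp
      then show "norm \<bar>f x - s i x\<bar> \<le> 3 * \<bar>f x\<bar>" by simp
    qed
    show "integrable lebesgue (\<lambda>x. 3 * \<bar>f x\<bar>)"
      by (intro integrable_mult_right integrable_abs lim.hyps)
    show "(\<lambda>x. \<bar>f x - s i x\<bar>) \<in> borel_measurable lebesgue" for i
      by (intro borel_measurable_integrable integrable_abs Bochner_Integration.integrable_diff lim.hyps)
  qed simp
  then have "\<forall>\<^sub>F i in sequentially. (LINT x|lebesgue. \<bar>f x - s i x\<bar>) < e / 2"
    using lim.prems by (intro order_tendstoD) auto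
  then obtain i where i: "(LINT x|lebesgue. \<bar>f x - s i x\<bar>) < e / 2"
    by (auto simp: eventually_sequentially)
  obtain g where g: "continuous_on UNIV g" "integrable lebesgue g" "(LINT x|lebesgue. \<bar>s i x - g x\<bar>) < e / 2"
    using lim.IH[of "e / 2" i] lim.prems by auto
  have "(LINT x|lebesgue. \<bar>f x - g x\<bar>) \<le> (LINT x|lebesgue. \<bar>f x - s i x\<bar> + \<bar>s i x - g x\<bar>)"
    using lim.hyps(1,4) g(2) by (intro integral_mono) auto
  also have "\<dots> < e"
    using lim.hyps(1,4) g i by simp
  finally show ?case using g by blast
qed

section \<open>Approximation in L^1(K) by networks\<close>

theorem theorem1:
  fixes K :: "(real ^ 'd) set" and f :: "real ^ 'd \<Rightarrow> real" and \<epsilon> :: real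
  assumes "compact K"
    and "set_integrable lebesgue K f"
    and "\<epsilon> > 0"
  shows "\<exists>A. two_layer_relu_addernet A \<and>
           (LINT X:K|lebesgue. \<bar>f X - A X\<bar>) \<le> \<epsilon>"
proof -
  let ?m = "measure lebesgue K"
  have K: "K \<in> lmeasurable" using assms(1) by (rule lmeasurable_compact)
  \<comment> \<open>Extension of \<open>f\<close> by zero outside \<open>K\<close>, so that density
    on the whole space applies.\<close>
  have f: "integrable lebesgue (\<lambda>x. indicator K x * f x)"
    using assms(2) by (simp add: set_integrable_def)
  obtain g where g: "continuous_on UNIV g" "integrable lebesgue g"
      "(LINT x|lebesgue. \<bar>indicator K x * f x - g x\<bar>) < \<epsilon> / 2"
    using integrable_lebesgue_approx_continuous[OF f, of "\<epsilon> / 2"] assms(3) by auto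
  \<comment> \<open>A uniform error \<eta> on \<open>K\<close> costs at most \<epsilon> / 2 in the
    integral; the summand 1 covers null sets \<open>K\<close>.\<close>
  define \<eta> where "\<eta> = \<epsilon> / (2 * (?m + 1))"
  have \<eta>: "\<eta> > 0"
    using assms(3) by (simp add: \<eta>_def add_nonneg_pos)
  have \<eta>m: "\<eta> * ?m \<le> \<epsilon> / 2"
    using assms(3) measure_nonneg[of lebesgue K]
    by (simp add: \<eta>_def divide_simps add_nonneg_eq_0_iff not_less del: measure_nonneg)
  obtain N :: nat and c w r where r: "0 \<le> r"
    and le: "\<And>X. X \<in> K \<Longrightarrow> \<bar>g X - (\<Sum>i<N. c i * bump r (w i) X)\<bar> \<le> \<eta>"
    by (rule uniform_approx_bump_sum[OF g(1) assms(1) \<eta>]) (rule that)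
  let ?A = "\<lambda>X. \<Sum>i<N. c i * bump r (w i) X"
  have "integrable lborel (\<lambda>x. indicator K x *\<^sub>R ?A x)"
    by (intro borel_integrable_compact assms continuous_intros continuous_on_bump)
  then have A: "integrable lebesgue (\<lambda>x. indicator K x * ?A x)"
    by (subst integrable_completion) (simp_all only: real_scaleR_def borel_measurable_integrable)
  \<comment> \<open>On \<open>K\<close> this is the triangle inequality through \<open>g\<close>;
    outside \<open>K\<close> the left integrand is 0 and the right one is \<bar>g x\<bar>.\<close>
  have "(LINT X:K|lebesgue. \<bar>f X - ?A X\<bar>)
      \<le> (LINT x|lebesgue. \<bar>indicator K x * f x - g x\<bar> + \<eta> * indicator K x)"
    unfolding set_lebesgue_integral_def
  proof (rule integral_mono)
    have "integrable lebesgue (\<lambda>x. \<bar>indicator K x * f x - indicator K x * ?A x\<bar>)"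
      by (intro integrable_abs Bochner_Integration.integrable_diff f A)
    moreover have "(\<lambda>x. \<bar>indicator K x * f x - indicator K x * ?A x\<bar>) = (\<lambda>x. indicator K x *\<^sub>R \<bar>f x - ?A x\<bar>)"
      by (auto simp: indicator_def fun_eq_iff)
    ultimately show "integrable lebesgue (\<lambda>x. indicator K x *\<^sub>R \<bar>f x - ?A x\<bar>)"
      by (simp only:)
    show "integrable lebesgue (\<lambda>x. \<bar>indicator K x * f x - g x\<bar> + \<eta> * indicator K x)"
      using f g(2) K by (auto simp: lmeasurable_iff_integrable)
    show "indicator K x *\<^sub>R \<bar>f x - ?A x\<bar>
        \<le> \<bar>indicator K x * f x - g x\<bar> + \<eta> * indicator K x" for x
      using le[of x] by (auto simp: indicator_def)
  qed
  also have "\<dots> = (LINT x|lebesgue. \<bar>indicator K x * f x - g x\<bar>) + \<eta> * ?m"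
    using f g(2) K by (subst Bochner_Integration.integral_add) (auto simp: lmeasurable_iff_integrable)
  also have "\<dots> \<le> \<epsilon>"
    using g(3) \<eta>m by simp
  finally have "(LINT X:K|lebesgue. \<bar>f X - ?A X\<bar>) \<le> \<epsilon>" .
  then show ?thesis
    by (intro exI[of _ ?A] conjI two_layer_relu_addernet_bump_sum r)
qed

end
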